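(* Let $\Phi$ be a block tridiagonal quantum Markov chain on $\mathbb{Z}$ with internal space $\mathbb{C}^N$, with blocks $A_k,B_k,C_k\in M_{N^2}(\mathbb{C})$, $k\in\mathbb{Z}$, in positions $(k+1,k)$, $(k,k)$, $(k-1,k)$ respectively, and all other blocks zero. Let $\breve\Phi$ be its folded block tridiagonal matrix on $\mathbb{Z}_{\ge 0}$ with $2N^2\times 2N^2$ blocks. Then for all $i,j\in\mathbb{Z}_{\ge 0}$ and all integers $n\ge 0$, $$\breve\Phi^{(n)}_{ji}=\begin{bmatrix}\Phi^{(n)}_{ji} & \Phi^{(n)}_{j,-i-1}\\ \Phi^{(n)}_{-j-1,i} & \Phi^{(n)}_{-j-1,-i-1}\end{bmatrix}.$$
   Context: A quantum Markov chain (QMC) on a vertex set $V$ with internal space $\mathbb{C}^N$ is a block matrix $\Phi=(\Phi_{ij})_{i,j\in V}$ of completely positive maps $\Phi_{ij}$ on $M_N(\mathbb{C})$ such that each column sum $\sum_{i\in V}\Phi_{ij}$ is trace-preserving; each $\Phi_{ij}$ is identified with the $N^2\times N^2$ matrix $M$ satisfying $\mathrm{vec}(\Phi_{ij}(X))=M\,\mathrm{vec}(X)$, where $\mathrm{vec}$ stacks the rows of a matrix. $\Phi^{(n)}_{ji}$ denotes the $(j,i)$ block ($N^2\times N^2$) of $\Phi^n$, $j,i\in\mathbb{Z}$, and $\breve\Phi^{(n)}_{ji}$ the $(j,i)$ block ($2N^2\times 2N^2$) of $\breve\Phi^n$, $j,i\in\mathbb{Z}_{\ge0}$. The folded matrix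 is $$\breve\Phi=\begin{bmatrix}G_0&N_1&&\\ M_0&G_1&N_2&\\ &M_1&G_2&N_3\\ &&\ddots&\ddots&\ddots\end{bmatrix},\qquad G_0=\begin{bmatrix}B_0&A_{-1}\\ C_0&B_{-1}\end{bmatrix},$$ $$M_n=\begin{bmatrix}A_n&0\\0&C_{-n-1}\end{bmatrix}\ (n\ge 0),\qquad G_n=\begin{bmatrix}B_n&0\\0&B_{-n-1}\end{bmatrix},\quad N_n=\begin{bmatrix}C_n&0\\0&A_{-n-1}\end{bmatrix}\ (n\ge 1).$$ *)

theory Defs
  imports "HOL-Analysis.Analysis"
begin

type_synonym 'n cmatrix = "complex ^ 'n ^ 'n"

text \<open>Matrices on \<open>\<complex>\<^sup>N \<otimes> \<complex>\<^sup>N\<close>, i.e. \<open>N\<^sup>2 \<times> N\<^sup>2\<close> matrices, with \<open>N = CARD('n)\<close>.\<close>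
type_synonym 'n opmatrix = "('n \<times> 'n) cmatrix"


section \<open>Completely positive maps and their matrices\<close>

text \<open>Positive semidefiniteness of the \<open>m \<times> m\<close> block matrix \<open>(X a b)\<close>, \<open>a, b < m\<close>, with
  \<open>N \<times> N\<close> blocks, tested on all vectors \<open>(v 0, \<dots>, v (m - 1))\<close> of \<open>\<complex>\<^sup>m\<^sup>N\<close>.\<close>
definition block_psd :: "nat \<Rightarrow> (nat \<Rightarrow> nat \<Rightarrow> 'n::finite cmatrix) \<Rightarrow> bool" where
  "block_psd m X \<longleftrightarrow> (\<forall>v :: nat \<Rightarrow> complex ^ 'n.
     (\<Sum>a<m. \<Sum>b<m. \<Sum>p\<in>UNIV. \<Sum>q\<in>UNIV. cnj (v a $ p) * X a b $ p $ q * v b $ q) \<in> \<real>\<^sub>\<ge>\<^sub>0)"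

definition complex_linear_map :: "('n::finite cmatrix \<Rightarrow> 'n cmatrix) \<Rightarrow> bool" where
  "complex_linear_map F \<longleftrightarrow> (\<forall>X Y. F (X + Y) = F X + F Y) \<and>
     (\<forall>c X. F (map_matrix ((*) c) X) = map_matrix ((*) c) (F X))"

text \<open>\<open>id\<^sub>m \<otimes> F\<close> is positive on \<open>M\<^sub>m(M\<^sub>N)\<close> for every \<open>m\<close>; it acts blockwise.\<close>
definition completely_positive :: "('n::finite cmatrix \<Rightarrow> 'n cmatrix) \<Rightarrow> bool" where
  "completely_positive F \<longleftrightarrow> complex_linear_map F \<and>
     (\<forall>m X. block_psd m X \<longrightarrow> block_psd m (\<lambda>a b. F (X a b)))"

definition trace_preserving :: "('n::finite cmatrix \<Rightarrow> 'n cmatrix) \<Rightarrow> bool" where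
  "trace_preserving F \<longleftrightarrow> (\<forall>X. trace (F X) = trace X)"

text \<open>Row stacking: the entry \<open>X $ p $ q\<close> goes to position \<open>(p, q)\<close>, pairs being thought of
  in lexicographic order.\<close>
definition vec_rows :: "'n::finite cmatrix \<Rightarrow> complex ^ ('n \<times> 'n)" where
  "vec_rows X = (\<chi> r. X $ fst r $ snd r)"

definition unvec_rows :: "complex ^ ('n \<times> 'n) \<Rightarrow> 'n::finite cmatrix" where
  "unvec_rows w = (\<chi> p q. w $ (p, q))"

definition map_of_opmatrix :: "'n::finite opmatrix \<Rightarrow> 'n cmatrix \<Rightarrow> 'n cmatrix" where
  "map_of_opmatrix M X = unvec_rows (M *v vec_rows X)"

lemma vec_rows_map_of_opmatrix: "vec_rows (map_of_opmatrix M X) = M *v vec_rows X"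
  by (simp add: map_of_opmatrix_def vec_rows_def unvec_rows_def vec_eq_iff)


section \<open>Quantum Markov chains\<close>

text \<open>The vertex set is the type \<open>'v\<close>. For infinite \<open>'v\<close> the column sums are required to
  converge (pointwise), since otherwise the infinite sum would default to \<open>0\<close>.\<close>
definition quantum_markov_chain :: "('v \<Rightarrow> 'v \<Rightarrow> 'n::finite cmatrix \<Rightarrow> 'n cmatrix) \<Rightarrow> bool" where
  "quantum_markov_chain F \<longleftrightarrow>
     (\<forall>i j. completely_positive (F i j)) \<and>
     (\<forall>j. (\<forall>X. (\<lambda>i. F i j X) summable_on UNIV) \<and>
          trace_preserving (\<lambda>X. \<Sum>\<^sub>\<infinity>i. F i j X))"


section \<open>Powers of infinite block matrices\<close>

definition block_mult ::
  "('v \<Rightarrow> 'v \<Rightarrow> 's::finite cmatrix) \<Rightarrow> ('v \<Rightarrow> 'v \<Rightarrow> 's cmatrix) \<Rightarrow> 'v \<Rightarrow> 'v \<Rightarrow> 's cmatrix" where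
  "block_mult P Q = (\<lambda>i j. \<Sum>\<^sub>\<infinity>k. P i k ** Q k j)"

primrec block_power ::
  "('v \<Rightarrow> 'v \<Rightarrow> 's::finite cmatrix) \<Rightarrow> nat \<Rightarrow> 'v \<Rightarrow> 'v \<Rightarrow> 's cmatrix" where
  "block_power P 0 = (\<lambda>i j. if i = j then mat 1 else 0)"
| "block_power P (Suc n) = block_mult P (block_power P n)"


section \<open>Folding\<close>

text \<open>\<open>block2 a b c d\<close> is the block matrix with rows \<open>(a, b)\<close> and \<open>(c, d)\<close>.\<close>
definition block2 ::
  "'s::finite cmatrix \<Rightarrow> 's cmatrix \<Rightarrow> 's cmatrix \<Rightarrow> 's cmatrix \<Rightarrow> ('s + 's) cmatrix" where
  "block2 a b c d = (\<chi> r s. case r of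
      Inl p \<Rightarrow> (case s of Inl q \<Rightarrow> a $ p $ q | Inr q \<Rightarrow> b $ p $ q)
    | Inr p \<Rightarrow> (case s of Inl q \<Rightarrow> c $ p $ q | Inr q \<Rightarrow> d $ p $ q))"

context
  fixes A B C :: "int \<Rightarrow> 's::finite cmatrix"
begin

definition fold_M :: "nat \<Rightarrow> ('s + 's) cmatrix" where
  "fold_M n = block2 (A (int n)) 0 0 (C (- int n - 1))"

definition fold_G :: "nat \<Rightarrow> ('s + 's) cmatrix" where
  "fold_G n = (if n = 0 then block2 (B 0) (A (-1)) (C 0) (B (-1))
               else block2 (B (int n)) 0 0 (B (- int n - 1)))"

text \<open>Only used for \<open>n \<ge> 1\<close>.\<close>
definition fold_N :: "nat \<Rightarrow> ('s + 's) cmatrix" where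
  "fold_N n = block2 (C (int n)) 0 0 (A (- int n - 1))"

definition folded :: "nat \<Rightarrow> nat \<Rightarrow> ('s + 's) cmatrix" where
  "folded j i = (if j = i + 1 then fold_M i
                 else if j = i then fold_G i
                 else if i = j + 1 then fold_N i
                 else 0)"

end


section \<open>Block tridiagonal matrices on the integers\<close>

definition block_tridiagonal ::
  "(int \<Rightarrow> 's::finite cmatrix) \<Rightarrow> (int \<Rightarrow> 's cmatrix) \<Rightarrow> (int \<Rightarrow> 's cmatrix)
    \<Rightarrow> (int \<Rightarrow> int \<Rightarrow> 's cmatrix) \<Rightarrow> bool" where
  "block_tridiagonal A B C P \<longleftrightarrow>
     (\<forall>k. P (k + 1) k = A k \<and> P k k = B k \<and> P (k - 1) k = C k) \<and>
     (\<forall>j k. j \<notin> {k - 1, k, k + 1} \<longrightarrow> P j k = 0)"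

end

theory Submission
  imports Defs
begin

text \<open>
  Identifying \<open>\<int>\<close> with two copies of \<open>\<nat>\<close> via \<open>k\<close> and \<open>- k - 1\<close> groups any block matrix on
  \<open>\<int>\<close> into a block matrix on \<open>\<nat>\<close> with blocks of twice the size. This regrouping is
  multiplicative whenever the left factor has finitely supported rows, and it maps a
  tridiagonal matrix to its folded matrix.
\<close>

definition regroup :: "(int \<Rightarrow> int \<Rightarrow> 's::finite cmatrix) \<Rightarrow> nat \<Rightarrow> nat \<Rightarrow> ('s + 's) cmatrix" where
  "regroup P j i = block2 (P (int j) (int i)) (P (int j) (- int i - 1))
    (P (- int j - 1) (int i)) (P (- int j - 1) (- int i - 1))"

lemma sum_UNIV_Plus:
  fixes f :: "'a::finite + 'b::finite \<Rightarrow> 'c::comm_monoid_add"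
  shows "(\<Sum>x\<in>UNIV. f x) = (\<Sum>a\<in>UNIV. f (Inl a)) + (\<Sum>b\<in>UNIV. f (Inr b))"
  by (simp add: UNIV_Plus_UNIV[symmetric] sum.Plus del: UNIV_Plus_UNIV)

lemma block2_mult:
  "block2 a b c d ** block2 a' b' c' d' =
    block2 (a ** a' + b ** c') (a ** b' + b ** d') (c ** a' + d ** c') (c ** b' + d ** d')"
  by (simp add: block2_def matrix_matrix_mult_def vec_eq_iff sum_UNIV_Plus split: sum.splits)

lemma block2_add:
  "block2 a b c d + block2 a' b' c' d' = block2 (a + a') (b + b') (c + c') (d + d')"
  by (simp add: block2_def vec_eq_iff split: sum.splits)

lemma block2_0: "block2 0 0 0 0 = 0"
  by (simp add: block2_def vec_eq_iff split: sum.splits)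

lemma block2_mat_1: "block2 (mat 1) 0 0 (mat 1) = mat 1"
  by (simp add: block2_def mat_def vec_eq_iff split: sum.splits)

lemma sum_block2:
  "(\<Sum>k\<in>K. block2 (a k) (b k) (c k) (d k)) =
    block2 (\<Sum>k\<in>K. a k) (\<Sum>k\<in>K. b k) (\<Sum>k\<in>K. c k) (\<Sum>k\<in>K. d k)"
  by (induction K rule: infinite_finite_induct) (simp_all add: block2_0 block2_add)

text \<open>Outside \<open>S\<close> the left factor kills every term, so the infinite sum is an
  ordinary finite one and no convergence question arises for \<open>Q\<close>.\<close>

lemma block_mult_finite:
  assumes "finite S" and "\<And>k. k \<notin> S \<Longrightarrow> P i k = 0"
  shows "block_mult P Q i j = (\<Sum>k\<in>S. P i k ** Q k j)"
proof -
  have "(\<Sum>\<^sub>\<infinity>k. P i k ** Q k j) = (\<Sum>\<^sub>\<infinity>k\<in>S. P i k ** Q k j)"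
    by (rule infsum_cong_neutral) (auto simp: assms(2))
  then show ?thesis
    using assms(1) by (simp add: block_mult_def)
qed

text \<open>Both embeddings of \<open>K\<close> are injective, and their images are disjoint because
  one is nonnegative and the other negative.\<close>

lemma sum_int_halves:
  fixes f :: "int \<Rightarrow> 'a::comm_monoid_add"
  assumes "finite K"
  shows "sum f (int ` K \<union> (\<lambda>k. - int k - 1) ` K) = (\<Sum>k\<in>K. f (int k) + f (- int k - 1))"
proof -
  have "sum f (int ` K \<union> (\<lambda>k. - int k - 1) ` K)
      = sum f (int ` K) + sum f ((\<lambda>k. - int k - 1) ` K)"
    by (rule sum.union_disjoint) (use assms in auto)
  then show ?thesis
    by (simp add: sum.reindex inj_on_def sum.distrib)
qed

lemma regroup_block_mult:
  assumes "\<And>x. finite {k. P x k \<noteq> 0}"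
  shows "regroup (block_mult P Q) = block_mult (regroup P) (regroup Q)"
proof (intro ext)
  fix j i
  \<comment> \<open>Block row \<open>j\<close> of \<open>regroup P\<close> consists of exactly these
    two rows of \<open>P\<close>; \<open>T\<close> is their joint support.\<close>
  define T where "T = {k. P (int j) k \<noteq> 0} \<union> {k. P (- int j - 1) k \<noteq> 0}"
  \<comment> \<open>\<open>S\<close> closes \<open>T\<close> under the reflection of
    \<open>k\<close> to \<open>- k - 1\<close>, so that a sum over \<open>S\<close> splits into
    pairs indexed by \<open>K\<close>, one pair per block column.\<close>
  define K where "K = int -` T \<union> (\<lambda>k. - int k - 1) -` T"
  define S where "S = int ` K \<union> (\<lambda>k. - int k - 1) ` K"
  have "finite T"
    by (simp add: T_def assms)
  then have K: "finite K"
    by (simp add: K_def finite_vimageI inj_def)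
  then have S: "finite S"
    by (simp add: S_def)
  have "T \<subseteq> S"
  proof
    fix k assume k: "k \<in> T"
    show "k \<in> S"
    proof (cases "0 \<le> k")
      case True
      then have "nat k \<in> K" "k = int (nat k)"
        using k by (simp_all add: K_def)
      then show ?thesis
        unfolding S_def by blast
    next
      case False
      then have "nat (- k - 1) \<in> K" "k = - int (nat (- k - 1)) - 1"
        using k by (simp_all add: K_def)
      then show ?thesis
        unfolding S_def by blast
    qed
  qed
  then have P: "P x k = 0" if "k \<notin> S" "x = int j \<or> x = - int j - 1" for x k
    using that by (auto simp: T_def)
  have mult: "block_mult P Q x y =
      (\<Sum>k\<in>K. P x (int k) ** Q (int k) y + P x (- int k - 1) ** Q (- int k - 1) y)"
    if "x = int j \<or> x = - int j - 1" for x y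
    using block_mult_finite[OF S, of P x Q y] P that by (simp add: S_def sum_int_halves[OF K])
  \<comment> \<open>Here \<open>int k\<close> and \<open>- int k - 1\<close> both lie outside
    \<open>T\<close>, so all four blocks vanish.\<close>
  have "regroup P j k = 0" if "k \<notin> K" for k
    using that by (simp add: K_def T_def regroup_def block2_0)
  then have "block_mult (regroup P) (regroup Q) j i = (\<Sum>k\<in>K. regroup P j k ** regroup Q k i)"
    by (rule block_mult_finite[OF K])
  then show "regroup (block_mult P Q) j i = block_mult (regroup P) (regroup Q) j i"
    by (simp add: regroup_def block2_mult sum_block2 mult)
qed

text \<open>Powers grow by multiplying with \<open>P\<close> on the left, so finite rows are needed
  for \<open>P\<close> alone and not for its powers.\<close>

lemma regroup_block_power:
  assumes "\<And>x. finite {k. P x k \<noteq> 0}"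
  shows "regroup (block_power P n) = block_power (regroup P) n"
proof (induction n)
  case 0
  show ?case
    by (auto simp: fun_eq_iff regroup_def block2_0 block2_mat_1)
next
  case (Suc n)
  then show ?case
    by (simp add: regroup_block_mult assms)
qed

lemma block_tridiagonal_eq:
  assumes "block_tridiagonal A B C P"
  shows "P j k = (if j = k + 1 then A k else if j = k then B k else if j = k - 1 then C k else 0)"
  using assms by (auto simp: block_tridiagonal_def)

lemma finite_row_block_tridiagonal:
  assumes "block_tridiagonal A B C P"
  shows "finite {k. P x k \<noteq> 0}"
  by (rule finite_subset[of _ "{x - 1, x, x + 1}"])
    (auto simp: block_tridiagonal_eq[OF assms] split: if_splits)

text \<open>Reflection reverses direction on the negative half, which swaps the roles of
  \<open>A\<close> and \<open>C\<close> there. The halves touch only between \<open>0\<close> and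
  \<open>-1\<close>, whence the off-diagonal blocks \<open>A (-1)\<close> and \<open>C 0\<close> of
  \<open>fold_G 0\<close>.\<close>

lemma regroup_block_tridiagonal:
  assumes "block_tridiagonal A B C P"
  shows "regroup P = folded A B C"
proof (intro ext)
  fix j i :: nat
  consider "j = i + 1" | "j = i" | "i = j + 1" | "j > i + 1" | "i > j + 1"
    by linarith
  then show "regroup P j i = folded A B C j i"
    by cases (auto simp: regroup_def folded_def fold_M_def fold_G_def fold_N_def block2_0
        block_tridiagonal_eq[OF assms])
qed

theorem proposition7p1:
  fixes \<Phi> :: "int \<Rightarrow> int \<Rightarrow> 'n::finite opmatrix"
    and A B C :: "int \<Rightarrow> 'n opmatrix"
    and i j n :: nat
  assumes "quantum_markov_chain (\<lambda>i j. map_of_opmatrix (\<Phi> i j))"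
    and "block_tridiagonal A B C \<Phi>"
  shows "block_power (folded A B C) n j i =
    block2 (block_power \<Phi> n (int j) (int i)) (block_power \<Phi> n (int j) (- int i - 1))
           (block_power \<Phi> n (- int j - 1) (int i)) (block_power \<Phi> n (- int j - 1) (- int i - 1))"
  using regroup_block_power[OF finite_row_block_tridiagonal[OF assms(2)], where n = n]
  by (simp add: regroup_block_tridiagonal[OF assms(2)] fun_eq_iff regroup_def)

end
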